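(* (i) Let $R$ be a reduced ring having three or fewer minimal prime ideals. Then $R$ is rr-good. (ii) A reduced ring with four minimal prime ideals need not be rr-good; that is, there exists a reduced ring with exactly four minimal prime ideals which is not rr-good.
   Context: All rings are unitary (not necessarily commutative). A ring is reduced if it has no non-zero nilpotent elements. The reduced ring order (rr-order) on a reduced ring $R$ is the partial order $a\le_{\mathrm{rr}} b$ if and only if $ab=a^2$. $R$ is called rr-good if it is a lower semi-lattice in this order, i.e. every pair $a,b\in R$ has an infimum $a\wedge_{\mathrm{rr}} b$. *)

theory Defs
  imports "HOL-Algebra.Algebra"
begin

text \<open>Rings are the unitary, not necessarily commutative rings of the locale \<^locale>\<open>ring\<close>;
  the zero ring is included (it has no prime ideals).\<close>

locale reduced_ring = ring +
  assumes reduced: "\<lbrakk>x \<in> carrier R; x [^] (n::nat) = \<zero>\<rbrakk> \<Longrightarrow> x = \<zero>"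

definition rr_order :: "('a, 'm) ring_scheme \<Rightarrow> 'a gorder" where
  "rr_order R = \<lparr>carrier = carrier R, eq = (=),
     le = (\<lambda>a b. a \<otimes>\<^bsub>R\<^esub> b = a [^]\<^bsub>R\<^esub> (2::nat))\<rparr>"

text \<open>The locale \<^locale>\<open>lower_semilattice\<close> contains the partial order axioms. For a reduced ring
  these always hold, so only the existence of binary infima is in question; see
  \<open>rr_good_iff\<close> below.\<close>

definition rr_good :: "('a, 'm) ring_scheme \<Rightarrow> bool" where
  "rr_good R \<longleftrightarrow> lower_semilattice (rr_order R)"

text \<open>The library's \<^locale>\<open>primeideal\<close> is restricted to commutative rings. This is the usual notion
  for arbitrary rings, stated with products of two-sided ideals.\<close>

definition prime_ideal :: "('a, 'm) ring_scheme \<Rightarrow> 'a set \<Rightarrow> bool" where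
  "prime_ideal R P \<longleftrightarrow> ideal P R \<and> P \<noteq> carrier R \<and>
     (\<forall>I J. ideal I R \<longrightarrow> ideal J R \<longrightarrow> ideal_prod R I J \<subseteq> P \<longrightarrow> I \<subseteq> P \<or> J \<subseteq> P)"

definition minimal_primes :: "('a, 'm) ring_scheme \<Rightarrow> 'a set set" where
  "minimal_primes R = {P. prime_ideal R P \<and> (\<forall>Q. prime_ideal R Q \<longrightarrow> Q \<subseteq> P \<longrightarrow> Q = P)}"

context reduced_ring
begin

lemma square_zeroD: "x \<in> carrier R \<Longrightarrow> x \<otimes> x = \<zero> \<Longrightarrow> x = \<zero>"
  using reduced[of x 2] by (simp add: numeral_2_eq_2)

lemma mult_zero_commute:
  assumes "a \<in> carrier R" "b \<in> carrier R" "a \<otimes> b = \<zero>"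
  shows "b \<otimes> a = \<zero>"
proof (rule square_zeroD)
  have "(b \<otimes> a) \<otimes> (b \<otimes> a) = b \<otimes> (a \<otimes> b) \<otimes> a"
    using assms(1,2) by (simp add: m_assoc)
  then show "(b \<otimes> a) \<otimes> (b \<otimes> a) = \<zero>"
    using assms by simp
qed (use assms in simp)

lemma rr_antisym:
  assumes c: "a \<in> carrier R" "b \<in> carrier R" and ab: "a \<otimes> b = a \<otimes> a" and ba: "b \<otimes> a = b \<otimes> b"
  shows "a = b"
proof -
  have "(a \<ominus> b) \<otimes> (a \<ominus> b) = (a \<otimes> a \<ominus> a \<otimes> b) \<ominus> (b \<otimes> a \<ominus> b \<otimes> b)"
    using c by algebra
  also have "\<dots> = \<zero>" using c by (simp add: ab ba r_neg minus_eq)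
  finally have "a \<ominus> b = \<zero>" using c square_zeroD[of "a \<ominus> b"] by simp
  then show ?thesis using c by simp
qed

lemma rr_trans:
  assumes c: "a \<in> carrier R" "b \<in> carrier R" "c \<in> carrier R"
    and ab: "a \<otimes> b = a \<otimes> a" and bc: "b \<otimes> c = b \<otimes> b"
  shows "a \<otimes> c = a \<otimes> a"
proof -
  define x where "x = a \<otimes> (c \<ominus> a)"
  have x: "x \<in> carrier R" using c by (simp add: x_def)
  have "a \<otimes> (a \<otimes> c) = (a \<otimes> b) \<otimes> c" using c by (simp add: ab m_assoc)
  also have "\<dots> = (a \<otimes> b) \<otimes> b" using c by (simp add: m_assoc bc)
  also have "\<dots> = a \<otimes> (a \<otimes> b)" using c by (simp add: ab m_assoc)
  also have "\<dots> = a \<otimes> (a \<otimes> a)" by (simp add: ab)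
  finally have eq: "a \<otimes> (a \<otimes> c) = a \<otimes> (a \<otimes> a)" .
  have "a \<otimes> x = a \<otimes> (a \<otimes> c) \<ominus> a \<otimes> (a \<otimes> a)"
    unfolding x_def using c by algebra
  then have "a \<otimes> x = \<zero>" using c by (simp add: eq r_neg minus_eq)
  then have "x \<otimes> a = \<zero>" using mult_zero_commute[OF c(1) x] by simp
  then have "x \<otimes> a \<otimes> (c \<ominus> a) = \<zero>" using c by simp
  then have "x \<otimes> x = \<zero>" using c x m_assoc[of x a "c \<ominus> a"] by (simp add: x_def)
  then have "x = \<zero>" using square_zeroD[OF x] by simp
  moreover have "x = a \<otimes> c \<ominus> a \<otimes> a"
    unfolding x_def using c by algebra
  ultimately show ?thesis using c by simp
qed

lemma partial_order_rr_order: "partial_order (rr_order R)"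
proof -
  have sq: "x [^] (2::nat) = x \<otimes> x" if "x \<in> carrier R" for x
    using that by (simp add: numeral_2_eq_2)
  show ?thesis
  proof
    fix x y z assume "x \<sqsubseteq>\<^bsub>rr_order R\<^esub> y" "y \<sqsubseteq>\<^bsub>rr_order R\<^esub> z"
      "x \<in> carrier (rr_order R)" "y \<in> carrier (rr_order R)" "z \<in> carrier (rr_order R)"
    then show "x \<sqsubseteq>\<^bsub>rr_order R\<^esub> z"
      using rr_trans[of x y z] by (simp add: rr_order_def sq)
  next
    fix x y assume "x \<sqsubseteq>\<^bsub>rr_order R\<^esub> y" "y \<sqsubseteq>\<^bsub>rr_order R\<^esub> x"
      "x \<in> carrier (rr_order R)" "y \<in> carrier (rr_order R)"
    then show "x .=\<^bsub>rr_order R\<^esub> y"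
      using rr_antisym[of x y] by (simp add: rr_order_def sq)
  qed (simp_all add: rr_order_def sq)
qed

lemma rr_good_iff:
  "rr_good R \<longleftrightarrow> (\<forall>a\<in>carrier R. \<forall>b\<in>carrier R. \<exists>c. greatest (rr_order R) c (Lower (rr_order R) {a, b}))"
  using partial_order_rr_order
  by (simp add: rr_good_def lower_semilattice_def lower_semilattice_axioms_def Ball_def)
     (simp add: rr_order_def)

end

end

theory Submission
  imports Defs
begin

text \<open>Complements of maximal multiplicative systems avoiding \<open>0\<close> are completely prime minimal
  primes and intersect in \<open>0\<close>, so a reduced ring with at most three minimal primes embeds into a
  product of at most three domains. There, \<open>c \<le> a\<close> means that \<open>c\<close> agrees with \<open>a\<close> on the support of
  \<open>c\<close>, hence a common lower bound of \<open>a\<close> and \<open>b\<close> is determined by its support. If \<open>a \<noteq> b\<close>, these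
  supports lie in a set of at most two elements, where any two are comparable or disjoint; lower
  bounds with disjoint supports can be added, so one of maximal support is the greatest.
  With four components the supports can have three elements, and \<open>{0, 1}\<close> and \<open>{1, 2}\<close> need not have
  an upper bound.\<close>

section \<open>Completely prime minimal primes of reduced rings\<close>

text \<open>The elementwise form of primality: the quotient by \<open>Q\<close> is a non-zero ring
  without zero divisors. In noncommutative rings this is stronger than
  \<open>prime_ideal\<close>.\<close>

definition completely_prime :: "('a, 'm) ring_scheme \<Rightarrow> 'a set \<Rightarrow> bool" where
  "completely_prime R Q \<longleftrightarrow> ideal Q R \<and> \<one>\<^bsub>R\<^esub> \<notin> Q \<and>
     (\<forall>x\<in>carrier R. \<forall>y\<in>carrier R. x \<otimes>\<^bsub>R\<^esub> y \<in> Q \<longrightarrow> x \<in> Q \<or> y \<in> Q)"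

lemma completely_prime_imp_prime_ideal:
  assumes "completely_prime R Q"
  shows "prime_ideal R Q"
proof -
  have Q: "ideal Q R" and one: "\<one>\<^bsub>R\<^esub> \<notin> Q"
    and prime: "\<And>x y. x \<in> carrier R \<Longrightarrow> y \<in> carrier R \<Longrightarrow> x \<otimes>\<^bsub>R\<^esub> y \<in> Q \<Longrightarrow> x \<in> Q \<or> y \<in> Q"
    using assms by (auto simp: completely_prime_def)
  interpret ideal Q R by (rule Q)
  have "I \<subseteq> Q \<or> J \<subseteq> Q" if "ideal I R" "ideal J R" "ideal_prod R I J \<subseteq> Q" for I J
  proof (rule ccontr)
    assume "\<not> (I \<subseteq> Q \<or> J \<subseteq> Q)"
    then obtain i j where "i \<in> I" "i \<notin> Q" "j \<in> J" "j \<notin> Q" by blast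
    moreover from this have "i \<otimes>\<^bsub>R\<^esub> j \<in> Q"
      using that(3) ideal_prod.prod[of i I j J R] by (auto simp: subset_iff)
    moreover have "i \<in> carrier R" "j \<in> carrier R"
      using \<open>i \<in> I\<close> \<open>j \<in> J\<close> that(1,2) ideal.Icarr by metis+
    ultimately show False using prime by blast
  qed
  with Q one one_closed show ?thesis unfolding prime_ideal_def by auto
qed

lemma (in ideal) diff_mem:
  "x \<in> I \<Longrightarrow> y \<in> I \<Longrightarrow> x \<ominus> y \<in> I"
  by (simp add: minus_eq)

section \<open>Vanishing products and maximal multiplicative systems\<close>

context reduced_ring
begin

text \<open>Since ba = 0, the square of arb contains the vanishing factor ba, and reducedness
  applies.\<close>

lemma mult_insert_zero:
  assumes c: "a \<in> carrier R" "r \<in> carrier R" "b \<in> carrier R" and "a \<otimes> b = \<zero>"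
  shows "a \<otimes> (r \<otimes> b) = \<zero>"
proof (rule square_zeroD)
  have "b \<otimes> a = \<zero>" using mult_zero_commute assms by blast
  have "(a \<otimes> (r \<otimes> b)) \<otimes> (a \<otimes> (r \<otimes> b)) = a \<otimes> r \<otimes> (b \<otimes> a) \<otimes> r \<otimes> b"
    using c by (simp add: m_assoc)
  then show "(a \<otimes> (r \<otimes> b)) \<otimes> (a \<otimes> (r \<otimes> b)) = \<zero>"
    using c \<open>b \<otimes> a = \<zero>\<close> by simp
qed (use c in simp)

text \<open>Together with \<open>mult_zero_commute\<close> and \<open>mult_insert_zero\<close>, this
  allows factors of a vanishing product to be rearranged as in a commutative ring. Inserting c into
  a(bc) = 0 gives (acb)c = 0; inserting a and multiplying by b on the right gives (acb)(acb) =
  0.\<close>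

lemma mult_swap_zero:
  assumes c: "a \<in> carrier R" "b \<in> carrier R" "c \<in> carrier R" and "a \<otimes> (b \<otimes> c) = \<zero>"
  shows "a \<otimes> (c \<otimes> b) = \<zero>"
proof (rule square_zeroD)
  have "a \<otimes> (c \<otimes> (b \<otimes> c)) = \<zero>"
    using assms by - (rule mult_insert_zero, simp_all)
  then have "(a \<otimes> (c \<otimes> b)) \<otimes> (a \<otimes> c) = \<zero>"
    using mult_insert_zero[of "a \<otimes> (c \<otimes> b)" a c] c by (simp add: m_assoc)
  then have "(a \<otimes> (c \<otimes> b)) \<otimes> (a \<otimes> c) \<otimes> b = \<zero>"
    using c by simp
  then show "(a \<otimes> (c \<otimes> b)) \<otimes> (a \<otimes> (c \<otimes> b)) = \<zero>"
    using c by (simp add: m_assoc)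
qed (use c in simp)

text \<open>A left annihilator is a left ideal in any ring; reducedness makes it two-sided, via
  \<open>mult_insert_zero\<close>.\<close>

lemma annihilator_ideal:
  assumes "A \<subseteq> carrier R"
  shows "ideal {x \<in> carrier R. \<forall>y\<in>A. x \<otimes> y = \<zero>} R" (is "ideal ?I R")
proof (rule idealI)
  show "ring R" by (rule ring_axioms)
  show "subgroup ?I (add_monoid R)"
  proof (rule add.subgroupI)
    show "?I \<noteq> {}" using assms by (auto intro!: exI[of _ \<zero>])
  qed (use assms in \<open>auto simp: l_distr l_minus subset_iff\<close>)
next
  fix a x assume "a \<in> ?I" "x \<in> carrier R"
  then show "x \<otimes> a \<in> ?I" using assms by (auto simp: m_assoc subset_iff)
next
  fix a x assume "a \<in> ?I" "x \<in> carrier R"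
  then show "a \<otimes> x \<in> ?I" using assms mult_insert_zero by (auto simp: m_assoc subset_iff)
qed

text \<open>Zorn's lemma, starting from the powers of \<open>x\<close>, none of which is 0 because
  the ring is reduced.\<close>

lemma ex_maximal_submonoid:
  assumes x: "x \<in> carrier R" "x \<noteq> \<zero>"
  obtains T where "submonoid T R" "\<zero> \<notin> T" "x \<in> T"
    "\<And>T'. submonoid T' R \<Longrightarrow> \<zero> \<notin> T' \<Longrightarrow> T \<subseteq> T' \<Longrightarrow> T' = T"
proof -
  define A where "A = {T. submonoid T R \<and> \<zero> \<notin> T \<and> x \<in> T}"
  have "\<exists>M\<in>A. \<forall>S\<in>A. M \<subseteq> S \<longrightarrow> S = M"
  proof (rule subset_Zorn_nonempty)
    have "submonoid (range (\<lambda>n. x [^] (n::nat))) R"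
      using x by unfold_locales (auto simp: nat_pow_mult intro: range_eqI[of _ _ "0::nat"])
    moreover have "\<zero> \<notin> range (\<lambda>n. x [^] (n::nat))"
      using x reduced by (metis imageE)
    moreover have "x \<in> range (\<lambda>n. x [^] (n::nat))"
      using x by (auto intro: range_eqI[of _ _ "1::nat"])
    ultimately show "A \<noteq> {}" by (auto simp: A_def)
  next
    fix \<C> assume "\<C> \<noteq> {}" and ch: "subset.chain A \<C>"
    have "submonoid (\<Union>\<C>) R"
    proof
      show "\<Union>\<C> \<subseteq> carrier R" "\<one> \<in> \<Union>\<C>"
        using ch \<open>\<C> \<noteq> {}\<close> by (auto simp: A_def subset_chain_def submonoid_def subset_iff)
    next
      fix a b assume "a \<in> \<Union>\<C>" "b \<in> \<Union>\<C>"
      then obtain U V where UV: "U \<in> \<C>" "a \<in> U" "V \<in> \<C>" "b \<in> V" by blast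
      then have "U \<subseteq> V \<or> V \<subseteq> U" using ch by (auto simp: A_def subset_chain_def)
      moreover have "submonoid U R" "submonoid V R"
        using ch UV by (auto simp: A_def subset_chain_def)
      ultimately show "a \<otimes> b \<in> \<Union>\<C>"
        using UV submonoid.m_closed by (metis UnionI subsetD)
    qed
    then show "\<Union>\<C> \<in> A"
      using ch \<open>\<C> \<noteq> {}\<close> by (auto simp: A_def subset_chain_def)
  qed
  then obtain T where "T \<in> A" and "\<And>S. S \<in> A \<Longrightarrow> T \<subseteq> S \<Longrightarrow> S = T" by metis
  \<comment> \<open>A submonoid containing \<open>T\<close> contains \<open>x\<close> as well, so
    maximality within \<open>A\<close> is maximality among all submonoids avoiding 0.\<close>
  then show ?thesis using that[of T] by (auto simp: A_def)
qed

text \<open>This describes the complement of \<open>T\<close> by equations, which makes it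
  accessible to ideal arithmetic. If nothing in \<open>T\<close> kills \<open>x\<close>, then
  \<open>T\<close> can be enlarged by \<open>x\<close> without reaching 0. The enlargement is
  defined by a cancellation property instead of by words in \<open>T\<close> and \<open>x\<close>,
  so that closure under products is immediate.\<close>

lemma notin_maximal_submonoid_iff:
  assumes T: "submonoid T R" "\<zero> \<notin> T"
    and max: "\<And>T'. submonoid T' R \<Longrightarrow> \<zero> \<notin> T' \<Longrightarrow> T \<subseteq> T' \<Longrightarrow> T' = T"
    and x: "x \<in> carrier R"
  shows "x \<notin> T \<longleftrightarrow> (\<exists>t\<in>T. t \<otimes> x = \<zero>)"
proof
  interpret T: submonoid T R by (rule T)
  have carr: "t \<in> carrier R" if "t \<in> T" for t
    using that T.subset by blast
  show "x \<notin> T" if "\<exists>t\<in>T. t \<otimes> x = \<zero>"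
    using that T(2) T.m_closed by metis
  show "\<exists>t\<in>T. t \<otimes> x = \<zero>" if "x \<notin> T"
  proof (rule ccontr)
    assume nz: "\<not> (\<exists>t\<in>T. t \<otimes> x = \<zero>)"
    \<comment> \<open>\<open>T'\<close> consists of the elements that are cancellable modulo the ideal of all \<open>z\<close> with
      \<open>t x z = 0\<close> for some \<open>t \<in> T\<close>.\<close>
    define I where "I = {z \<in> carrier R. \<exists>t\<in>T. t \<otimes> (x \<otimes> z) = \<zero>}"
    define T' where "T' = {y \<in> carrier R. \<forall>z\<in>carrier R. y \<otimes> z \<in> I \<longrightarrow> z \<in> I}"
    have T'I: "y \<in> T'"
      if "y \<in> carrier R" "\<And>z. z \<in> carrier R \<Longrightarrow> y \<otimes> z \<in> I \<Longrightarrow> z \<in> I" for y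
      unfolding T'_def using that by blast
    have T'D: "z \<in> I" if "y \<in> T'" "z \<in> carrier R" "y \<otimes> z \<in> I" for y z
      using that unfolding T'_def by blast
    have T'_carr: "y \<in> carrier R" if "y \<in> T'" for y
      using that unfolding T'_def by blast
    have "submonoid T' R"
    proof
      show "T' \<subseteq> carrier R" using T'_carr by blast
      show "\<one> \<in> T'" by (rule T'I) simp_all
    next
      fix y w assume yw: "y \<in> T'" "w \<in> T'"
      then have carr_yw: "y \<in> carrier R" "w \<in> carrier R" by (simp_all add: T'_carr)
      show "y \<otimes> w \<in> T'"
      proof (rule T'I)
        fix z assume z: "z \<in> carrier R" "y \<otimes> w \<otimes> z \<in> I"
        then have "y \<otimes> (w \<otimes> z) \<in> I"
          using carr_yw by (simp add: m_assoc)
        then have "w \<otimes> z \<in> I"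
          using T'D[OF yw(1)] carr_yw z(1) by simp
        then show "z \<in> I" using T'D[OF yw(2)] z(1) by blast
      qed (use carr_yw in simp)
    qed
    moreover have "\<zero> \<notin> T'"
    proof
      assume "\<zero> \<in> T'"
      \<comment> \<open>If 0 were cancellable modulo \<open>I\<close>, then 1 would lie in
        \<open>I\<close>, so some element of \<open>T\<close> would kill \<open>x\<close>.\<close>
      moreover have "\<one> \<otimes> (x \<otimes> \<zero>) = \<zero>" using x by simp
      then have "\<zero> \<in> I" unfolding I_def using T.one_closed by blast
      ultimately have "\<one> \<in> I" using T'D[of \<zero> \<one>] by simp
      then show False using nz x by (auto simp: I_def)
    qed
    moreover have "T \<subseteq> T'"
    proof
      fix s assume s: "s \<in> T"
      \<comment> \<open>The factor s is moved next to t: txsz = 0 becomes (ts)(xz) = 0, and ts is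
        again in \<open>T\<close>.\<close>
      have "z \<in> I" if z: "z \<in> carrier R" "s \<otimes> z \<in> I" for z
      proof -
        obtain t where t: "t \<in> T" "t \<otimes> (x \<otimes> (s \<otimes> z)) = \<zero>"
          using z by (auto simp: I_def)
        then have "(x \<otimes> (s \<otimes> z)) \<otimes> t = \<zero>"
          using mult_zero_commute[of t "x \<otimes> (s \<otimes> z)"] x z carr s by simp
        then have "x \<otimes> (s \<otimes> (z \<otimes> t)) = \<zero>"
          using x z carr s t by (simp add: m_assoc)
        then have "x \<otimes> (z \<otimes> t \<otimes> s) = \<zero>"
          using x z carr s t by - (rule mult_swap_zero, simp_all)
        then have "(x \<otimes> z) \<otimes> (t \<otimes> s) = \<zero>"
          using x z carr s t by (simp add: m_assoc)
        then have "(t \<otimes> s) \<otimes> (x \<otimes> z) = \<zero>"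
          using mult_zero_commute[of "x \<otimes> z" "t \<otimes> s"] x z carr s t by simp
        then show ?thesis using z s t by (auto simp: I_def)
      qed
      then show "s \<in> T'" using s carr T'I by blast
    qed
    moreover have "x \<in> T'"
    proof -
      \<comment> \<open>The repeated factor x is removed: txxz = 0 forces the square of txz to
        vanish.\<close>
      have "z \<in> I" if z: "z \<in> carrier R" "x \<otimes> z \<in> I" for z
      proof -
        obtain t where t: "t \<in> T" "t \<otimes> (x \<otimes> (x \<otimes> z)) = \<zero>"
          using z by (auto simp: I_def)
        have "t \<otimes> x \<otimes> (z \<otimes> x) = \<zero>"
          using t x z carr by - (rule mult_swap_zero, simp_all add: m_assoc)
        then have "(t \<otimes> (x \<otimes> z)) \<otimes> x = \<zero>"
          using t x z carr by (simp add: m_assoc)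
        then have "(t \<otimes> (x \<otimes> z)) \<otimes> (t \<otimes> x) = \<zero>"
          using t x z carr by - (rule mult_insert_zero, simp_all)
        then have "(t \<otimes> (x \<otimes> z)) \<otimes> (t \<otimes> x) \<otimes> z = \<zero>"
          using z by simp
        then have "(t \<otimes> (x \<otimes> z)) \<otimes> (t \<otimes> (x \<otimes> z)) = \<zero>"
          using t x z carr by (simp add: m_assoc)
        then have "t \<otimes> (x \<otimes> z) = \<zero>"
          using square_zeroD[of "t \<otimes> (x \<otimes> z)"] t x z carr by simp
        then show ?thesis using t z by (auto simp: I_def)
      qed
      then show ?thesis using x T'I by blast
    qed
    ultimately show False using max[of T'] that by blast
  qed
qed

text \<open>\<open>Q\<close> is the complement of a maximal submonoid \<open>T\<close> containing
  \<open>x\<close>. It is an ideal because its elements are those killed by some element of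
  \<open>T\<close>, and it is completely prime because \<open>T\<close> is closed under
  products.\<close>

lemma ex_completely_prime_minimal_prime:
  assumes x: "x \<in> carrier R" "x \<noteq> \<zero>"
  obtains Q where "completely_prime R Q" "Q \<in> minimal_primes R" "x \<notin> Q"
proof -
  obtain T where T: "submonoid T R" "\<zero> \<notin> T" "x \<in> T"
    and max: "\<And>T'. submonoid T' R \<Longrightarrow> \<zero> \<notin> T' \<Longrightarrow> T \<subseteq> T' \<Longrightarrow> T' = T"
    using ex_maximal_submonoid[OF x] by metis
  interpret T: submonoid T R by (rule T)
  have carr: "t \<in> carrier R" if "t \<in> T" for t
    using that T.subset by blast
  define Q where "Q = carrier R - T"
  have Q: "q \<in> Q \<longleftrightarrow> q \<in> carrier R \<and> (\<exists>t\<in>T. t \<otimes> q = \<zero>)" for q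
    using notin_maximal_submonoid_iff[OF T(1,2) max] by (auto simp: Q_def)
  have "ideal Q R"
  proof (rule idealI)
    show "ring R" by (rule ring_axioms)
    show "subgroup Q (add_monoid R)"
    proof (rule add.subgroupI)
      show "Q \<subseteq> carrier R" by (auto simp: Q_def)
      show "Q \<noteq> {}" using T(2) by (auto simp: Q_def)
    next
      fix a assume "a \<in> Q"
      then show "\<ominus> a \<in> Q" using carr by (auto simp: Q r_minus intro!: bexI)
    next
      fix a b assume "a \<in> Q" "b \<in> Q"
      then obtain s t where st: "s \<in> T" "t \<in> T" "a \<in> carrier R" "b \<in> carrier R"
        "s \<otimes> a = \<zero>" "t \<otimes> b = \<zero>" by (auto simp: Q)
      \<comment> \<open>The product st in \<open>T\<close> kills both a and b.\<close>
      then have "s \<otimes> (t \<otimes> a) = \<zero>" using carr by - (rule mult_insert_zero, simp_all)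
      then have "(s \<otimes> t) \<otimes> (a \<oplus> b) = \<zero>"
        using st carr by (simp add: r_distr m_assoc)
      then show "a \<oplus> b \<in> Q" using st by (auto simp: Q)
    qed
  next
    fix a r assume "a \<in> Q" "r \<in> carrier R"
    then show "r \<otimes> a \<in> Q" using mult_insert_zero carr unfolding Q by (meson m_closed)
  next
    fix a r assume "a \<in> Q" "r \<in> carrier R"
    then obtain t where "t \<in> T" "t \<otimes> a = \<zero>" "a \<in> carrier R" by (auto simp: Q)
    moreover from this have "t \<otimes> (a \<otimes> r) = \<zero>"
      using \<open>r \<in> carrier R\<close> carr by (simp flip: m_assoc)
    ultimately show "a \<otimes> r \<in> Q" using \<open>r \<in> carrier R\<close> by (auto simp: Q)
  qed
  then have cp: "completely_prime R Q"
    by (auto simp: completely_prime_def Q_def)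
  have "P = Q" if P: "prime_ideal R P" "P \<subseteq> Q" for P
  proof
    show "Q \<subseteq> P"
    proof
      fix q assume "q \<in> Q"
      then obtain t where t: "q \<in> carrier R" "t \<in> T" "t \<otimes> q = \<zero>" by (auto simp: Q)
      \<comment> \<open>\<open>J\<close> annihilates \<open>t\<close> and \<open>I\<close>
        annihilates \<open>J\<close>, so the product of these ideals is 0 and \<open>P\<close>
        contains one of them. It cannot be \<open>I\<close>: \<open>t\<close> is in \<open>I\<close>
        but outside \<open>Q\<close>, hence outside \<open>P\<close>. So \<open>P\<close> contains
        \<open>J\<close>, in which \<open>q\<close> lies.\<close>
      define J where "J = {y \<in> carrier R. \<forall>z\<in>{t}. y \<otimes> z = \<zero>}"
      define I where "I = {y \<in> carrier R. \<forall>z\<in>J. y \<otimes> z = \<zero>}"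
      have "ideal J R"
        unfolding J_def using t carr by - (rule annihilator_ideal, simp)
      moreover have "ideal I R"
        unfolding I_def by (rule annihilator_ideal) (auto simp: J_def)
      moreover have "y = \<zero>" if "y \<in> ideal_prod R I J" for y
        using that by induction (auto simp: I_def)
      moreover have "\<zero> \<in> P"
        using P(1) by (simp add: prime_ideal_def ideal.axioms additive_subgroup.zero_closed)
      ultimately have "I \<subseteq> P \<or> J \<subseteq> P"
        using P(1) unfolding prime_ideal_def by blast
      moreover have "q \<in> J"
        using mult_zero_commute[of t q] t carr by (simp add: J_def)
      moreover have "t \<in> I"
        using mult_zero_commute carr[OF t(2)] unfolding I_def J_def by blast
      ultimately show "q \<in> P" using P(2) t(2) by (auto simp: Q_def)
    qed
  qed (rule P(2))
  then have "Q \<in> minimal_primes R"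
    using completely_prime_imp_prime_ideal[OF cp] by (auto simp: minimal_primes_def)
  with cp show ?thesis using that T(3) by (auto simp: Q_def)
qed

section \<open>Infima in reduced rings with at most three minimal primes\<close>

lemma rr_good_iff_mult:
  "rr_good R \<longleftrightarrow> (\<forall>a\<in>carrier R. \<forall>b\<in>carrier R. \<exists>c\<in>carrier R.
     c \<otimes> a = c \<otimes> c \<and> c \<otimes> b = c \<otimes> c \<and>
     (\<forall>d\<in>carrier R. d \<otimes> a = d \<otimes> d \<longrightarrow> d \<otimes> b = d \<otimes> d \<longrightarrow> d \<otimes> c = d \<otimes> d))"
proof -
  have sq: "x [^] (2::nat) = x \<otimes> x" if "x \<in> carrier R" for x
    using that by (simp add: numeral_2_eq_2)
  have le: "x \<sqsubseteq>\<^bsub>rr_order R\<^esub> y \<longleftrightarrow> x \<otimes> y = x \<otimes> x" if "x \<in> carrier R" for x y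
    using that by (simp add: rr_order_def sq)
  have carr: "carrier (rr_order R) = carrier R"
    by (simp add: rr_order_def)
  have "greatest (rr_order R) c (Lower (rr_order R) {a, b}) \<longleftrightarrow> c \<in> carrier R \<and>
      c \<otimes> a = c \<otimes> c \<and> c \<otimes> b = c \<otimes> c \<and>
      (\<forall>d\<in>carrier R. d \<otimes> a = d \<otimes> d \<longrightarrow> d \<otimes> b = d \<otimes> d \<longrightarrow> d \<otimes> c = d \<otimes> d)"
    if "a \<in> carrier R" "b \<in> carrier R" for a b c
    unfolding greatest_def Lower_def carr using le that by blast
  then show ?thesis unfolding rr_good_iff by (simp add: Bex_def)
qed

text \<open>Restating the order as a vanishing product makes it expressible through
  supports.\<close>

lemma rr_le_iff:
  assumes "a \<in> carrier R" "b \<in> carrier R"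
  shows "a \<otimes> b = a \<otimes> a \<longleftrightarrow> a \<otimes> (b \<ominus> a) = \<zero>"
proof -
  have "a \<otimes> (b \<ominus> a) = a \<otimes> b \<ominus> a \<otimes> a"
    using assms by algebra
  then show ?thesis using assms by simp
qed

lemma rr_good_if_three_minimal_primes:
  assumes fin: "finite (minimal_primes R)" and card3: "card (minimal_primes R) \<le> 3"
  shows "rr_good R"
proof -
  define C where "C = {Q \<in> minimal_primes R. completely_prime R Q}"
  \<comment> \<open>The components at which \<open>x\<close> is non-zero. Only 0 has empty support,
    by \<open>ex_completely_prime_minimal_prime\<close>, and complete primality turns products into
    intersections of supports.\<close>
  define supp where "supp = (\<lambda>x. {Q \<in> C. x \<notin> Q})"
  have C: "finite C" "card C \<le> 3"
    using fin card3 card_mono[OF fin, of C] by (auto simp: C_def)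
  have ideal: "ideal Q R" if "Q \<in> C" for Q
    using that by (auto simp: C_def completely_prime_def)
  have supp_empty: "supp x = {} \<longleftrightarrow> x = \<zero>" if "x \<in> carrier R" for x
  proof
    show "x = \<zero>" if "supp x = {}"
      using that ex_completely_prime_minimal_prime[OF \<open>x \<in> carrier R\<close>]
      by (auto simp: supp_def C_def)
    show "supp x = {}" if "x = \<zero>"
      using that ideal by (auto simp: supp_def ideal.axioms additive_subgroup.zero_closed)
  qed
  have supp_mult: "supp (x \<otimes> y) = supp x \<inter> supp y" if "x \<in> carrier R" "y \<in> carrier R" for x y
    using that ideal
    by (auto simp: supp_def C_def completely_prime_def ideal.I_l_closed ideal.I_r_closed)
  have le_iff: "x \<otimes> y = x \<otimes> x \<longleftrightarrow> (\<forall>Q\<in>C. x \<notin> Q \<longrightarrow> y \<ominus> x \<in> Q)"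
    if "x \<in> carrier R" "y \<in> carrier R" for x y
  proof -
    have "x \<otimes> y = x \<otimes> x \<longleftrightarrow> supp (x \<otimes> (y \<ominus> x)) = {}"
      using that supp_empty[of "x \<otimes> (y \<ominus> x)"] by (simp add: rr_le_iff)
    also have "\<dots> \<longleftrightarrow> supp x \<inter> supp (y \<ominus> x) = {}"
      using that supp_mult[of x "y \<ominus> x"] by simp
    finally show ?thesis by (auto simp: supp_def)
  qed
  show ?thesis
    unfolding rr_good_iff_mult
  proof (intro ballI)
    fix a b assume ab: "a \<in> carrier R" "b \<in> carrier R"
    define L where "L = {c \<in> carrier R. c \<otimes> a = c \<otimes> c \<and> c \<otimes> b = c \<otimes> c}"
    have "\<exists>c\<in>L. \<forall>d\<in>L. d \<otimes> c = d \<otimes> d"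
    proof (cases "a = b")
      case True
      then show ?thesis using ab by (auto simp: L_def)
    next
      case False
      then obtain Q0 where Q0: "Q0 \<in> C" "a \<ominus> b \<notin> Q0"
        using ab supp_empty[of "a \<ominus> b"] by (auto simp: supp_def)
      have L: "c \<in> L \<longleftrightarrow> c \<in> carrier R \<and> (\<forall>Q\<in>C. c \<notin> Q \<longrightarrow> a \<ominus> c \<in> Q \<and> b \<ominus> c \<in> Q)" for c
        using le_iff ab by (auto simp: L_def)
      \<comment> \<open>At \<open>Q0\<close> the elements \<open>a\<close> and \<open>b\<close>
        differ. A lower bound that is non-zero there would agree with both.\<close>
      have sub: "supp c \<subseteq> C - {Q0}" if "c \<in> L" for c
      proof -
        have "c \<in> Q0"
        proof (rule ccontr)
          assume "c \<notin> Q0"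
          then have "a \<ominus> c \<in> Q0" "b \<ominus> c \<in> Q0" and c: "c \<in> carrier R"
            using that Q0(1) L by blast+
          then have "(a \<ominus> c) \<ominus> (b \<ominus> c) \<in> Q0"
            using ideal.diff_mem[OF ideal[OF Q0(1)]] by blast
          moreover have "(a \<ominus> c) \<ominus> (b \<ominus> c) = a \<ominus> b"
            using ab c by algebra
          ultimately show False using Q0(2) by simp
        qed
        then show ?thesis by (auto simp: supp_def)
      qed
      have card2: "card (C - {Q0}) \<le> 2"
        using C Q0(1) by simp
      have disjoint_or_comparable: "supp c \<inter> supp d = {} \<or> supp d \<subseteq> supp c \<or> supp c \<subseteq> supp d"
        if "c \<in> L" "d \<in> L" for c d
      proof (rule ccontr)
        assume "\<not> ?thesis"
        \<comment> \<open>Overlapping, incomparable sets have a common point and one private point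
          each, which makes three.\<close>
        then obtain P1 P2 P3 where P: "P1 \<in> supp c \<inter> supp d" "P2 \<in> supp d - supp c"
          "P3 \<in> supp c - supp d" by blast
        then have "{P1, P2, P3} \<subseteq> C - {Q0}"
          using sub that by blast
        then have "card {P1, P2, P3} \<le> 2"
          using card_mono[of "C - {Q0}" "{P1, P2, P3}"] C(1) card2 by (meson finite_Diff le_trans)
        moreover have "P1 \<noteq> P2" "P1 \<noteq> P3" "P2 \<noteq> P3" using P by auto
        ultimately show False by simp
      qed
      have "\<zero> \<in> L" using ab by (simp add: L_def)
      moreover have "card (supp c) < Suc (card C)" for c
        using card_mono[of C "supp c"] C(1) by (auto simp: supp_def less_Suc_eq_le)
      ultimately obtain c where c: "c \<in> L" and max: "\<And>d. d \<in> L \<Longrightarrow> card (supp d) \<le> card (supp c)"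
        using ex_has_greatest_nat[of "\<lambda>c. c \<in> L" \<zero> "\<lambda>c. card (supp c)" "Suc (card C)"] by (metis less_imp_le)
      \<comment> \<open>On the support of \<open>d\<close> both \<open>c\<close> and
        \<open>d\<close> agree with \<open>a\<close>, hence with each other.\<close>
      have le_if_subset: "d \<otimes> c = d \<otimes> d" if d: "d \<in> L" "supp d \<subseteq> supp c" for d
      proof -
        have cd: "c \<in> carrier R" "d \<in> carrier R" using c d by (auto simp: L)
        have "c \<ominus> d \<in> Q" if Q: "Q \<in> C" "d \<notin> Q" for Q
        proof -
          have "c \<notin> Q" using d Q by (auto simp: supp_def)
          then have "a \<ominus> d \<in> Q" "a \<ominus> c \<in> Q" using c d Q L by blast+
          then have "(a \<ominus> d) \<ominus> (a \<ominus> c) \<in> Q"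
            using ideal.diff_mem[OF ideal[OF Q(1)]] by blast
          moreover have "(a \<ominus> d) \<ominus> (a \<ominus> c) = c \<ominus> d"
            using ab cd by algebra
          ultimately show ?thesis by simp
        qed
        then show ?thesis using le_iff cd by simp
      qed
      have "d \<otimes> c = d \<otimes> d" if d: "d \<in> L" for d
      proof (cases "supp c \<inter> supp d = {}")
        case True
        have cd: "c \<in> carrier R" "d \<in> carrier R" using c d by (auto simp: L)
        then have zero: "c \<otimes> d = \<zero>" "d \<otimes> c = \<zero>"
          using True by (auto simp: supp_mult simp flip: supp_empty)
        \<comment> \<open>As cd = dc = 0, the square of c + d is cc + dd = ca + da, and likewise for
          b. The support of the sum contains both supports, so the maximality of \<open>c\<close>
          forces d = 0.\<close>
        then have "c \<oplus> d \<in> L"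
          using c d ab by (auto simp: L_def l_distr r_distr)
        then have le: "card (supp (c \<oplus> d)) \<le> card (supp c)" by (rule max)
        have sub: "supp c \<union> supp d \<subseteq> supp (c \<oplus> d)"
        proof -
          have "c \<otimes> (c \<oplus> d) = c \<otimes> c" "d \<otimes> (c \<oplus> d) = d \<otimes> d"
            using cd zero by (auto simp: r_distr)
          then have "supp c \<inter> supp (c \<oplus> d) = supp c \<inter> supp c"
            "supp d \<inter> supp (c \<oplus> d) = supp d \<inter> supp d"
            using cd supp_mult by (metis add.m_closed)+
          then show ?thesis by blast
        qed
        have fin_supp: "finite (supp x)" for x
          using C(1) by (simp add: supp_def)
        have "card (supp c) + card (supp d) = card (supp c \<union> supp d)"
          using True fin_supp by (simp add: card_Un_disjoint)
        also have "\<dots> \<le> card (supp (c \<oplus> d))"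
          using fin_supp sub by (rule card_mono)
        finally have "card (supp c) + card (supp d) \<le> card (supp (c \<oplus> d))" .
        with le have "card (supp d) = 0" by linarith
        then have "d = \<zero>" using fin_supp cd supp_empty by simp
        then show ?thesis using cd by simp
      next
        case False
        then have "supp d \<subseteq> supp c \<or> supp c \<subseteq> supp d"
          using disjoint_or_comparable c d by blast
        \<comment> \<open>The support of \<open>d\<close> has at most as many elements as that of
          \<open>c\<close>, so this inclusion is an equality.\<close>
        moreover have "supp d = supp c" if "supp c \<subseteq> supp d"
          using that max[OF d] C(1) card_seteq[of "supp d" "supp c"] by (simp add: supp_def)
        ultimately show ?thesis using le_if_subset d by blast
      qed
      then show ?thesis using c by blast
    qed
    then show "\<exists>c\<in>carrier R. c \<otimes> a = c \<otimes> c \<and> c \<otimes> b = c \<otimes> c \<and>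
       (\<forall>d\<in>carrier R. d \<otimes> a = d \<otimes> d \<longrightarrow> d \<otimes> b = d \<otimes> d \<longrightarrow> d \<otimes> c = d \<otimes> d)"
      by (auto simp: L_def)
  qed
qed

end

text \<open>In the commutative case the product of the principal ideals of \<open>x\<close> and
  \<open>y\<close> consists of sums of multiples of xy, so ideal primality yields the elementwise
  condition.\<close>

lemma (in cring) prime_ideal_mult_mem:
  assumes P: "prime_ideal R P" and xy: "x \<in> carrier R" "y \<in> carrier R" "x \<otimes> y \<in> P"
  shows "x \<in> P \<or> y \<in> P"
proof -
  interpret ideal P R using P by (simp add: prime_ideal_def)
  have "z \<in> P" if "z \<in> ideal_prod R (PIdl x) (PIdl y)" for z
    using that
  proof induction
    case (prod i j)
    then obtain r s where rs: "r \<in> carrier R" "s \<in> carrier R" "i = r \<otimes> x" "j = s \<otimes> y"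
      by (auto simp: cgenideal_def)
    then have "i \<otimes> j = (r \<otimes> s) \<otimes> (x \<otimes> y)"
      using xy by (simp add: m_ac)
    then show ?case using rs xy I_l_closed by simp
  qed (rule a_closed)
  then have "PIdl x \<subseteq> P \<or> PIdl y \<subseteq> P"
    using P xy cgenideal_ideal unfolding prime_ideal_def by blast
  then show ?thesis using xy cgenideal_self by blast
qed

section \<open>A reduced ring with four minimal primes that is not rr-good\<close>

text \<open>The elements of \<open>\<int>\<^sup>4\<close> are encoded as sequences that are constant from index 3 on.\<close>

definition example_ring :: "(nat \<Rightarrow> int) ring" where
  "example_ring = \<lparr>carrier = {x. (\<forall>i>3. x i = x 3) \<and> (\<forall>i>0. even (x i) \<longleftrightarrow> even (x 0)) \<and>
       4 dvd x 0 + x 1 + x 2 + x 3},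
     monoid.mult = (\<lambda>x y i. x i * y i), monoid.one = (\<lambda>_. 1), ring.zero = (\<lambda>_. 0), ring.add = (\<lambda>x y i. x i + y i)\<rparr>"

lemma example_carrier:
  "x \<in> carrier example_ring \<longleftrightarrow> (\<forall>i>3. x i = x 3) \<and> (\<forall>i>0. even (x i) \<longleftrightarrow> even (x 0)) \<and>
     4 dvd x 0 + x 1 + x 2 + x 3"
  unfolding example_ring_def by simp

text \<open>Closure of the example under multiplication. With \<open>x i = x 0 + 2 * u i\<close>,
  the sum condition says that \<open>u 1 + u 2 + u 3\<close> is even, and similarly for
  \<open>y\<close> and \<open>v\<close>. In the sum of products, these even sums occur with a factor
  2, and all remaining terms are multiples of 4.\<close>

lemma four_dvd_sum_mult:
  fixes x y :: "nat \<Rightarrow> int"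
  assumes "\<And>i. i > 0 \<Longrightarrow> even (x i) \<longleftrightarrow> even (x 0)" "4 dvd x 0 + x 1 + x 2 + x 3"
    and "\<And>i. i > 0 \<Longrightarrow> even (y i) \<longleftrightarrow> even (y 0)" "4 dvd y 0 + y 1 + y 2 + y 3"
  shows "4 dvd x 0 * y 0 + x 1 * y 1 + x 2 * y 2 + x 3 * y 3"
proof -
  have ex: "\<exists>z. \<forall>i. w i = w 0 + 2 * z i" if "\<And>i. i > 0 \<Longrightarrow> even (w i) \<longleftrightarrow> even (w 0)" for w :: "nat \<Rightarrow> int"
  proof (intro exI allI)
    show "w i = w 0 + 2 * ((w i - w 0) div 2)" for i
      using that[of i] by (cases "i = 0") simp_all
  qed
  obtain u v where u: "\<And>i. x i = x 0 + 2 * u i" and v: "\<And>i. y i = y 0 + 2 * v i"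
    using ex[of x] ex[of y] assms by metis
  have "2 * (u 1 + u 2 + u 3) = (x 0 + x 1 + x 2 + x 3) - 4 * x 0"
    unfolding u[of 1] u[of 2] u[of 3] by simp
  moreover have "2 * (v 1 + v 2 + v 3) = (y 0 + y 1 + y 2 + y 3) - 4 * y 0"
    unfolding v[of 1] v[of 2] v[of 3] by simp
  ultimately have "4 dvd 2 * (u 1 + u 2 + u 3)" "4 dvd 2 * (v 1 + v 2 + v 3)"
    using assms(2,4) by (metis dvd_diff dvd_triv_left)+
  then obtain k l where k: "2 * (u 1 + u 2 + u 3) = 4 * k" and l: "2 * (v 1 + v 2 + v 3) = 4 * l"
    unfolding dvd_def by blast
  have "x 0 * y 0 + x 1 * y 1 + x 2 * y 2 + x 3 * y 3 =
      4 * (x 0 * y 0) + x 0 * (2 * (v 1 + v 2 + v 3)) + y 0 * (2 * (u 1 + u 2 + u 3))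
      + 4 * (u 1 * v 1 + u 2 * v 2 + u 3 * v 3)"
    unfolding u[of 1] u[of 2] u[of 3] v[of 1] v[of 2] v[of 3] by (simp add: algebra_simps)
  also have "\<dots> = 4 * (x 0 * y 0 + x 0 * l + y 0 * k + (u 1 * v 1 + u 2 * v 2 + u 3 * v 3))"
    unfolding k l by (simp add: algebra_simps)
  finally show ?thesis by (rule dvdI)
qed

section \<open>Ring structure and minimal primes of the example\<close>

interpretation example: cring example_ring
proof (rule cringI)
  show "abelian_group example_ring"
  proof (rule abelian_groupI)
    fix x y assume "x \<in> carrier example_ring" "y \<in> carrier example_ring"
    moreover have "4 dvd (a + b) + (a' + b') + (a'' + b'') + (a''' + b''')"
      if "4 dvd a + a' + a'' + a'''" "4 dvd b + b' + b'' + b'''" for a b a' b' a'' b'' a''' b''' :: int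
      using dvd_add[OF that] by (simp add: algebra_simps)
    ultimately show "x \<oplus>\<^bsub>example_ring\<^esub> y \<in> carrier example_ring"
      by (auto simp: example_ring_def)
  next
    fix x assume x: "x \<in> carrier example_ring"
    have "- x 0 + - x 1 + - x 2 + - x 3 = - (x 0 + x 1 + x 2 + x 3)" by simp
    then have "4 dvd - x 0 + - x 1 + - x 2 + - x 3"
      using x unfolding example_carrier by (metis dvd_minus_iff)
    then have "(\<lambda>i. - x i) \<in> carrier example_ring"
      using x by (simp add: example_carrier)
    moreover have "(\<lambda>i. - x i) \<oplus>\<^bsub>example_ring\<^esub> x = \<zero>\<^bsub>example_ring\<^esub>"
      by (simp add: example_ring_def)
    ultimately show "\<exists>y\<in>carrier example_ring. y \<oplus>\<^bsub>example_ring\<^esub> x = \<zero>\<^bsub>example_ring\<^esub>"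
      by blast
  qed (auto simp: example_ring_def)
  show "comm_monoid example_ring"
  proof (rule comm_monoidI)
    fix x y assume "x \<in> carrier example_ring" "y \<in> carrier example_ring"
    then show "x \<otimes>\<^bsub>example_ring\<^esub> y \<in> carrier example_ring"
      using four_dvd_sum_mult[of x y] by (auto simp: example_ring_def)
  qed (auto simp: example_ring_def mult_ac)
qed (auto simp: example_ring_def algebra_simps)

lemma example_pow: "x [^]\<^bsub>example_ring\<^esub> (n::nat) = (\<lambda>i. x i ^ n)"
  by (induction n) (simp_all add: example_ring_def nat_pow_def mult_ac)

interpretation example: reduced_ring example_ring
proof
  show "x = \<zero>\<^bsub>example_ring\<^esub>"
    if "x \<in> carrier example_ring" "x [^]\<^bsub>example_ring\<^esub> (n::nat) = \<zero>\<^bsub>example_ring\<^esub>" for x n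
    using that unfolding example_pow by (auto simp: example_ring_def fun_eq_iff)
qed

text \<open>The kernel of a coordinate projection to the integers. All indices from 3 on give the
  same kernel, whence the bound \<open>k < 4\<close> below.\<close>

definition example_prime :: "nat \<Rightarrow> (nat \<Rightarrow> int) set" where
  "example_prime k = {x \<in> carrier example_ring. x k = 0}"

lemma prime_ideal_example_prime: "prime_ideal example_ring (example_prime k)"
proof (rule completely_prime_imp_prime_ideal)
  have "ideal (example_prime k) example_ring"
  proof (rule idealI)
    show "subgroup (example_prime k) (add_monoid example_ring)"
    proof (rule example.add.subgroupI)
      show "example_prime k \<noteq> {}"
        by (auto simp: example_prime_def example_ring_def intro!: exI[of _ "\<lambda>_. 0"])
    next
      fix x assume x: "x \<in> example_prime k"
      then have "x \<oplus>\<^bsub>example_ring\<^esub> (\<ominus>\<^bsub>example_ring\<^esub> x) = \<zero>\<^bsub>example_ring\<^esub>"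
        by (simp add: example_prime_def example.r_neg)
      then have "x k + (\<ominus>\<^bsub>example_ring\<^esub> x) k = 0"
        by (simp add: example_ring_def fun_eq_iff)
      then show "\<ominus>\<^bsub>example_ring\<^esub> x \<in> example_prime k"
        using x by (simp add: example_prime_def)
    next
      fix x y assume "x \<in> example_prime k" "y \<in> example_prime k"
      moreover have "(x \<oplus>\<^bsub>example_ring\<^esub> y) k = x k + y k" for x y
        by (simp add: example_ring_def)
      ultimately show "x \<oplus>\<^bsub>example_ring\<^esub> y \<in> example_prime k"
        by (simp add: example_prime_def)
    qed (auto simp: example_prime_def)
  next
    fix a x assume a: "a \<in> example_prime k" and x: "x \<in> carrier example_ring"
    have [simp]: "(x \<otimes>\<^bsub>example_ring\<^esub> y) k = x k * y k" for x y
      by (simp add: example_ring_def)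
    show "x \<otimes>\<^bsub>example_ring\<^esub> a \<in> example_prime k" "a \<otimes>\<^bsub>example_ring\<^esub> x \<in> example_prime k"
      using a x by (auto simp: example_prime_def)
  qed (rule example.ring_axioms)
  then show "completely_prime example_ring (example_prime k)"
    by (auto simp: completely_prime_def example_prime_def) (auto simp: example_ring_def)
qed

lemma example_prime_subset_iff:
  assumes "j < 4" "k < 4"
  shows "example_prime j \<subseteq> example_prime k \<longleftrightarrow> j = k"
proof
  assume sub: "example_prime j \<subseteq> example_prime k"
  \<comment> \<open>A multiple of the \<open>k\<close>-th unit vector; the entry 4 meets both the
    parity and the sum condition, and \<open>min i 3\<close> keeps the sequence constant from index
    3 on.\<close>
  define e :: "nat \<Rightarrow> int" where "e = (\<lambda>i. if min i 3 = k then 4 else 0)"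
  have "e \<in> carrier example_ring"
    by (auto simp: example_ring_def e_def)
  then show "j = k"
    using sub assms by (auto simp: example_prime_def e_def split: if_splits)
qed simp

text \<open>Otherwise each of the four kernels has an element outside \<open>P\<close>. Their
  product vanishes in every coordinate, so it lies in \<open>P\<close>, against primality.\<close>

lemma ex_example_prime_subset:
  assumes P: "prime_ideal example_ring P"
  shows "\<exists>k<4. example_prime k \<subseteq> P"
proof (rule ccontr)
  assume "\<not> (\<exists>k<4. example_prime k \<subseteq> P)"
  then have "\<forall>k<4. \<exists>x. x \<in> carrier example_ring \<and> x k = 0 \<and> x \<notin> P"
    by (auto simp: example_prime_def subset_iff)
  then obtain x where x: "\<And>k. k < 4 \<Longrightarrow> x k \<in> carrier example_ring \<and> x k k = 0 \<and> x k \<notin> P"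
    by metis
  let ?p = "(x 0 \<otimes>\<^bsub>example_ring\<^esub> x 1) \<otimes>\<^bsub>example_ring\<^esub> (x 2 \<otimes>\<^bsub>example_ring\<^esub> x 3)"
  have c: "x 0 \<in> carrier example_ring" "x 1 \<in> carrier example_ring"
    "x 2 \<in> carrier example_ring" "x 3 \<in> carrier example_ring"
    using x by simp_all
  have "?p i = 0" for i
  proof (cases "i < 3")
    case True
    then have "i = 0 \<or> i = 1 \<or> i = 2" by linarith
    then show ?thesis using x[of i] by (auto simp: example_ring_def)
  next
    case False
    then have "i = 3 \<or> i > 3" by linarith
    then show ?thesis using x[of 3] by (auto simp: example_ring_def)
  qed
  then have "?p = \<zero>\<^bsub>example_ring\<^esub>" by (simp add: example_ring_def fun_eq_iff)
  then have "?p \<in> P"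
    using P by (simp add: prime_ideal_def ideal.axioms additive_subgroup.zero_closed)
  then have "x 0 \<in> P \<or> x 1 \<in> P \<or> x 2 \<in> P \<or> x 3 \<in> P"
    using example.prime_ideal_mult_mem[OF P] c by (meson example.m_closed)
  then show False using x[of 0] x[of 1] x[of 2] x[of 3] by simp
qed

text \<open>Every prime contains one of the four kernels, and these are pairwise
  incomparable.\<close>

lemma minimal_primes_example: "minimal_primes example_ring = example_prime ` {..<4}"
proof
  show "minimal_primes example_ring \<subseteq> example_prime ` {..<4}"
    using ex_example_prime_subset prime_ideal_example_prime
    by (fastforce simp: minimal_primes_def)
  show "example_prime ` {..<4} \<subseteq> minimal_primes example_ring"
  proof
    fix P assume "P \<in> example_prime ` {..<4}"
    then obtain k where k: "k < 4" "P = example_prime k" by auto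
    have "Q = P" if Q: "prime_ideal example_ring Q" "Q \<subseteq> P" for Q
    proof -
      obtain j where j: "j < 4" "example_prime j \<subseteq> Q"
        using ex_example_prime_subset[OF Q(1)] by blast
      then have "j = k" using Q k example_prime_subset_iff[of j k] by blast
      then show ?thesis using Q j k by blast
    qed
    then show "P \<in> minimal_primes example_ring"
      using prime_ideal_example_prime k by (simp add: minimal_primes_def)
  qed
qed

lemma card_minimal_primes_example: "card (minimal_primes example_ring) = 4"
proof -
  have "inj_on example_prime {..<4}"
    using example_prime_subset_iff by (auto simp: inj_on_def)
  then show ?thesis by (simp add: minimal_primes_example card_image)
qed

text \<open>For the elements \<open>(2, 2, 2, 2)\<close> and \<open>(2, 2, 2, -2)\<close>, the common lower bounds are
  \<open>0\<close>, \<open>(2, 2, 0, 0)\<close>, \<open>(2, 0, 2, 0)\<close> and \<open>(0, 2, 2, 0)\<close>: the upper bound \<open>(2, 2, 2, 0)\<close>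
  of these is excluded by the condition on the sum.\<close>

lemma not_rr_good_example: "\<not> rr_good example_ring"
proof
  assume good: "rr_good example_ring"
  define a b c d :: "nat \<Rightarrow> int" where
    "a = (\<lambda>_. 2)" and "b = (\<lambda>i. if i < 3 then 2 else -2)"
    and "c = (\<lambda>i. if i < 2 then 2 else 0)" and "d = (\<lambda>i. if i = 1 \<or> i = 2 then 2 else 0)"
  have carr: "a \<in> carrier example_ring" "b \<in> carrier example_ring"
    "c \<in> carrier example_ring" "d \<in> carrier example_ring"
    by (auto simp: example_ring_def a_def b_def c_def d_def)
  have le_iff: "x \<otimes>\<^bsub>example_ring\<^esub> y = x \<otimes>\<^bsub>example_ring\<^esub> x \<longleftrightarrow> (\<forall>i. x i = 0 \<or> y i = x i)" for x y
    by (auto simp: example_ring_def fun_eq_iff)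
  obtain m where m: "m \<in> carrier example_ring" "\<forall>i. m i = 0 \<or> a i = m i" "\<forall>i. m i = 0 \<or> b i = m i"
    and max: "\<forall>x\<in>carrier example_ring. (\<forall>i. x i = 0 \<or> a i = x i) \<longrightarrow>
      (\<forall>i. x i = 0 \<or> b i = x i) \<longrightarrow> (\<forall>i. x i = 0 \<or> m i = x i)"
    using bspec[OF bspec[OF good[unfolded example.rr_good_iff_mult le_iff] carr(1)] carr(2)]
    by (elim bexE conjE)
  have "\<forall>i. c i = 0 \<or> a i = c i" "\<forall>i. c i = 0 \<or> b i = c i"
    "\<forall>i. d i = 0 \<or> a i = d i" "\<forall>i. d i = 0 \<or> b i = d i"
    by (simp_all add: a_def b_def c_def d_def)
  then have "\<forall>i. c i = 0 \<or> m i = c i" "\<forall>i. d i = 0 \<or> m i = d i"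
    using max carr(3,4) by blast+
  \<comment> \<open>The supports of \<open>c\<close> and \<open>d\<close> together cover the indices
    0, 1 and 2, and \<open>m\<close> agrees with each on its support.\<close>
  then have "m 0 = 2" "m 1 = 2" "m 2 = 2"
    by (auto simp: c_def d_def dest: spec[of _ 0] spec[of _ 1] spec[of _ 2])
  \<comment> \<open>A non-zero value would have to equal both 2 and -2. The coordinate sum of
    \<open>m\<close> is therefore 6, which 4 does not divide.\<close>
  moreover have "m 3 = 0"
    using spec[OF m(2), of 3] spec[OF m(3), of 3] unfolding a_def b_def by presburger
  moreover have "4 dvd m 0 + m 1 + m 2 + m 3"
    using m(1) unfolding example_carrier by blast
  ultimately show False by simp
qed

theorem proposition2p13:
  shows "(\<forall>R :: ('a, 'm) ring_scheme.
            reduced_ring R \<and> finite (minimal_primes R) \<and> card (minimal_primes R) \<le> 3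
              \<longrightarrow> rr_good R)
       \<and> (\<exists>R :: (nat \<Rightarrow> int) ring.
            reduced_ring R \<and> card (minimal_primes R) = 4 \<and> \<not> rr_good R)"
  using reduced_ring.rr_good_if_three_minimal_primes example.reduced_ring_axioms
    card_minimal_primes_example not_rr_good_example
  by blast

end
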